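(* Let $u$ be a finite word, let $v$ be its reverse, and let $|u|=n$. If $w$ is a prefix of $u'u^\omega$ and also a prefix of $v'v^\omega$, where $u'$ is a suffix of $u$ and $v'$ is a suffix of $v$, then $w$ is a palindromic periodicity with period $n$.
   Context: Words are sequences of letters; $|w|$ is the length of $w$, that is, the number of letters it contains. The reverse of $w[1]w[2]\cdots w[n]$ is $w[n]\cdots w[2]w[1]$. A word is a palindrome if it equals its reverse; the empty word is a palindrome. A factor is a contiguous block of a word; a prefix is a factor starting at the first position and a suffix is a factor ending at the last position; suffixes may be empty. For a word $x$, $x^\omega=xxx\cdots$ is the infinite concatenation of $x$ with itself. A palindromic periodicity is a factor, of length at least $|ps|$, of an infinite word $(ps)^\omega$ where $p$ and $s$ are palindromes (either of which may be empty). Its period is $|ps|$ (and its half-period is $|ps|/2$).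
   Formalization: The word w is assumed to have length at least n, which the definition of a palindromic periodicity with period n requires (the claim fails for shorter w, such as the empty word), and u is assumed nonempty so that the infinite word is defined. *)

theory Defs
  imports Main "HOL-Library.Stream" "HOL-Library.Sublist"
begin

text \<open>
  Finite words are lists and infinite words are streams; for a nonempty word \<open>x\<close>, the infinite
  word \<open>x\<^sup>\<omega>\<close> is \<open>cycle x\<close> (the value of \<open>cycle []\<close> is unspecified).
\<close>

definition palindrome :: "'a list \<Rightarrow> bool" where
  "palindrome w \<longleftrightarrow> rev w = w"

definition stream_prefix :: "'a list \<Rightarrow> 'a stream \<Rightarrow> bool" where
  "stream_prefix w s \<longleftrightarrow> (\<exists>t. s = w @- t)"

definition stream_factor :: "'a list \<Rightarrow> 'a stream \<Rightarrow> bool" where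
  "stream_factor w s \<longleftrightarrow> (\<exists>x t. s = x @- w @- t)"

text \<open>
  The period is the length \<open>|ps|\<close> of the repeated block, which need not be the least period
  of \<open>w\<close>.  One of \<open>p\<close>, \<open>s\<close> may be empty, but not both, as \<open>(ps)\<^sup>\<omega>\<close> would not be an infinite word.
\<close>

definition palindromic_periodicity_with_period :: "'a list \<Rightarrow> nat \<Rightarrow> bool" where
  "palindromic_periodicity_with_period w n \<longleftrightarrow>
     (\<exists>p s. palindrome p \<and> palindrome s \<and> p @ s \<noteq> [] \<and> length (p @ s) = n \<and>
            length (p @ s) \<le> length w \<and> stream_factor w (cycle (p @ s)))"

end

theory Submission
  imports Defs
begin

text \<open>
  Dropping a prefix from \<open>u\<^sup>\<omega>\<close> gives \<open>x\<^sup>\<omega>\<close> for a rotation \<open>x\<close> of \<open>u\<close>, and \<open>u'u\<^sup>\<omega>\<close> arises in this way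
  because \<open>u'\<close> is a suffix of \<open>u\<close>.  So \<open>w\<close> is a prefix of \<open>x\<^sup>\<omega>\<close> with \<open>x\<close> a rotation of \<open>u\<close>, and of
  \<open>y\<^sup>\<omega>\<close> with \<open>y\<close> a rotation of the reverse of \<open>u\<close>.  As \<open>w\<close> has at least \<open>n\<close> letters, its first \<open>n\<close>
  letters spell both \<open>x\<close> and \<open>y\<close>, so \<open>x = y\<close>.  Reversal carries rotations of \<open>u\<close> to
  rotations of the reverse of \<open>u\<close>, so \<open>x\<close> is a rotation of its own reverse
  (\<open>rev_eq_rotate_if_common_rotation\<close>).  Cutting \<open>x\<close> at the point of that rotation, \<open>x = ps\<close>
  has reverse \<open>sp\<close>; comparing blocks of equal length in \<open>rev s @ rev p = s @ p\<close> shows that \<open>p\<close>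
  and \<open>s\<close> are palindromes (\<open>rev_eq_rotate_imp_palindrome_factorization\<close>).
\<close>

lemma suffix_shift_cycle_eq_cycle_rotate:
  assumes "u \<noteq> []" and "suffix u' u"
  shows "\<exists>a. u' @- cycle u = cycle (rotate a u)"
proof -
  obtain z where z: "u = z @ u'"
    using assms(2) by (auto simp: suffix_def)
  have "cycle u = z @- (u' @- cycle u)"
    using cycle_decomp[OF assms(1)] z by (metis shift_append)
  then have "u' @- cycle u = sdrop (length z) (cycle u)"
    by (metis sdrop_shift drop_all order_refl diff_self_eq_0 sdrop.simps(1) shift.simps(1))
  also have "\<dots> = cycle (rotate (length z mod length u) u)"
    by (rule sdrop_cycle[OF assms(1)])
  finally show ?thesis by blast
qed

lemma take_stream_prefix_cycle:
  assumes "x \<noteq> []" and "stream_prefix w (cycle x)" and "length x \<le> length w"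
  shows "take (length x) w = x"
proof -
  obtain t where "cycle x = w @- t"
    using assms(2) by (auto simp: stream_prefix_def)
  then have "stake (length x) (cycle x) = take (length x) w"
    using assms(3) by (simp add: stake_shift)
  moreover have "stake (length x) (cycle x) = x"
    using cycle_decomp[OF assms(1)] stake_shift[of "length x" x "cycle x"] by simp
  ultimately show ?thesis by simp
qed

text \<open>
  Reversing \<open>x = rotate b (rev u)\<close> exhibits \<open>rev x\<close> as a rotation of \<open>u\<close>, and \<open>u\<close> is recovered
  from \<open>x = rotate a u\<close> by completing that rotation to a full turn.
\<close>

lemma rev_eq_rotate_if_common_rotation:
  assumes "x = rotate a u" and "x = rotate b (rev u)"
  shows "\<exists>c. rev x = rotate c x"
proof (cases "u = []")
  case True
  then show ?thesis using assms by simp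
next
  case False
  define d where "d = length u - a mod length u"
  have "(d + a) mod length u = (d + a mod length u) mod length u"
    by (simp add: mod_add_right_eq)
  also have "d + a mod length u = length u"
    using False by (simp add: d_def less_imp_le)
  finally have "rotate d x = u"
    by (simp add: assms(1) rotate_rotate rotate_id)
  moreover obtain m where "rev x = rotate m u"
    using assms(2) by (auto simp: rotate_rev)
  ultimately have "rev x = rotate (m + d) x"
    by (simp flip: rotate_rotate)
  then show ?thesis ..
qed

lemma rev_eq_rotate_imp_palindrome_factorization:
  assumes "rev x = rotate c x"
  shows "\<exists>p s. x = p @ s \<and> palindrome p \<and> palindrome s"
proof -
  define k where "k = c mod length x"
  have "rev (drop k x) @ rev (take k x) = rev x"
    by (simp flip: rev_append)
  also have "\<dots> = drop k x @ take k x"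
    by (simp add: assms rotate_drop_take k_def)
  finally have "rev (drop k x) = drop k x" and "rev (take k x) = take k x"
    by simp_all
  then show ?thesis
    unfolding palindrome_def by (metis append_take_drop_id)
qed

theorem theorem2p2:
  fixes u v u' v' w :: "'a list" and n :: nat
  assumes "u \<noteq> []"
    and "v = rev u"
    and "length u = n"
    and "suffix u' u"
    and "suffix v' v"
    and "stream_prefix w (u' @- cycle u)"
    and "stream_prefix w (v' @- cycle v)"
    and "n \<le> length w"
  shows "palindromic_periodicity_with_period w n"
proof -
  have "v \<noteq> []" using assms(1,2) by simp
  obtain a where a: "u' @- cycle u = cycle (rotate a u)"
    using suffix_shift_cycle_eq_cycle_rotate[OF assms(1,4)] by blast
  obtain b where b: "v' @- cycle v = cycle (rotate b v)"
    using suffix_shift_cycle_eq_cycle_rotate[OF \<open>v \<noteq> []\<close> assms(5)] by blast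
  define x where "x = rotate a u"
  have x: "x \<noteq> []" "length x = n" "stream_prefix w (cycle x)"
    using assms(1,3,6) a by (simp_all add: x_def)
  have "x = take n w"
    using take_stream_prefix_cycle[OF x(1,3)] x(2) assms(8) by simp
  also have "\<dots> = rotate b (rev u)"
    using take_stream_prefix_cycle[of "rotate b v" w] assms(1,2,3,7,8) b by simp
  finally obtain c where "rev x = rotate c x"
    using rev_eq_rotate_if_common_rotation[OF x_def] by blast
  then obtain p s where ps: "x = p @ s" "palindrome p" "palindrome s"
    using rev_eq_rotate_imp_palindrome_factorization by blast
  have "stream_factor w (cycle x)"
    using x(3) unfolding stream_prefix_def stream_factor_def by (metis shift.simps(1))
  then show ?thesis
    unfolding palindromic_periodicity_with_period_def using ps x(1,2) assms(8) by blast
qed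

end
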